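(* Consider the problem (P1) of minimizing $\tfrac12 x^THx+c^Tx+f_0(y)$ over $(x,y)\in\mathbb{R}^n\times\mathbb{R}^m$ subject to $x^Tx+f(y)\le 0$, where $n\ge 2$, $H=H^T\in\mathbb{R}^{n\times n}$ is not positive semidefinite, $c\in\mathbb{R}^n$, $f_0,f:\mathbb{R}^m\to\mathbb{R}$ are convex and twice continuously differentiable, and $\{y: f(y)<0\}\neq\emptyset$. Let $\lambda_1\le\lambda_2\le\dots\le\lambda_n$ be the eigenvalues of $H$ counted with multiplicity. Suppose $(x_*,y_* )$ is a local non-global minimizer of (P1). Then there exists $\mu^*\in(\max\{0,-\lambda_2\},-\lambda_1)$ such that $$(H+\mu^*I)x_*=-c,\qquad \nabla f_0(y_* )+\tfrac{\mu^*}{2}\nabla f(y_* )=0,\qquad x_*^Tx_*+f(y_* )=0.$$ Furthermore, if for every $y\in\mathbb{R}^m$ with $f(y)<0$ there is some $\mu_y>0$ with $\nabla^2f_0(y)+\frac{\mu_y}{2}\nabla^2f(y)\succ 0$, then $$\varphi'(\mu^* )\ \ge\ \tfrac12\nabla f(y_* )^T\Big[\nabla^2f_0(y_* )+\tfrac{\mu^*}{2}\nabla^2f(y_* )\Big]^{-1}\nabla f(y_* ),$$ where $\varphi(\mu)=\|(H+\mu I)^{-1}c\|^2$ for $\mu\in(-\lambda_2,-\lambda_1)$.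
   Context: A local non-global minimizer of a constrained problem is a feasible point that is a local minimizer but not a global minimizer. $I$ is the $n\times n$ identity matrix, $\|\cdot\|$ is the Euclidean norm, $P\succ 0$ means that the symmetric matrix $P$ is positive definite, and $\varphi'$ is the derivative of $\varphi$. *)

theory Defs
  imports "HOL-Analysis.Analysis" "HOL-Computational_Algebra.Polynomial"
begin

text \<open>Rows and columns of a real square matrix are indexed by a finite type, so \<open>n = CARD('n)\<close>.\<close>

definition psd :: "real^'n^'n \<Rightarrow> bool" where
  "psd A \<longleftrightarrow> transpose A = A \<and> (\<forall>v. 0 \<le> v \<bullet> (A *v v))"

definition posdef :: "real^'n^'n \<Rightarrow> bool" where
  "posdef A \<longleftrightarrow> transpose A = A \<and> (\<forall>v. v \<noteq> 0 \<longrightarrow> 0 < v \<bullet> (A *v v))"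

text \<open>The characteristic polynomial \<open>det (X I - A)\<close>, as a polynomial in \<open>X\<close>.\<close>

definition charpoly :: "real^'n^'n \<Rightarrow> real poly" where
  "charpoly A = det (\<chi> i j. (if i = j then [:0, 1:] else 0) - [:A $ i $ j:])"

lemma poly_charpoly: "poly (charpoly A) t = det (mat t - A)"
  unfolding charpoly_def det_def poly_sum poly_mult poly_prod of_int_poly
  by (intro sum.cong prod.cong arg_cong2[where f = "(*)"] refl) (simp_all add: mat_def)

text \<open>\<open>eigval A k\<close> is the \<open>k\<close>-th smallest (\<open>1 \<le> k \<le> n\<close>) eigenvalue of \<open>A\<close>, counted with
  algebraic multiplicity. The multiset \<open>proots\<close> has only the real roots, which are all the roots
  when \<open>A\<close> is symmetric; the value is meaningful only in that case.\<close>

definition eigval :: "real^'n^'n \<Rightarrow> nat \<Rightarrow> real" where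
  "eigval A k = sorted_list_of_multiset (proots (charpoly A)) ! (k - 1)"

definition grad :: "('a::real_inner \<Rightarrow> real) \<Rightarrow> 'a \<Rightarrow> 'a" where
  "grad f x = (THE D. GDERIV f x :> D)"

definition hess :: "(real^'m \<Rightarrow> real) \<Rightarrow> real^'m \<Rightarrow> real^'m^'m" where
  "hess f x = matrix (frechet_derivative (grad f) (at x))"

definition C2 :: "(real^'m \<Rightarrow> real) \<Rightarrow> bool" where
  "C2 f \<longleftrightarrow> (\<forall>x. f differentiable (at x)) \<and> (\<forall>x. grad f differentiable (at x)) \<and>
     continuous_on UNIV (hess f)"

definition local_minimizer :: "('a::metric_space \<Rightarrow> real) \<Rightarrow> 'a set \<Rightarrow> 'a \<Rightarrow> bool" where
  "local_minimizer F S z \<longleftrightarrow> z \<in> S \<and> (\<exists>e>0. \<forall>w\<in>S. dist w z < e \<longrightarrow> F z \<le> F w)"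

definition global_minimizer :: "('a \<Rightarrow> real) \<Rightarrow> 'a set \<Rightarrow> 'a \<Rightarrow> bool" where
  "global_minimizer F S z \<longleftrightarrow> z \<in> S \<and> (\<forall>w\<in>S. F z \<le> F w)"

definition local_nonglobal_minimizer :: "('a::metric_space \<Rightarrow> real) \<Rightarrow> 'a set \<Rightarrow> 'a \<Rightarrow> bool" where
  "local_nonglobal_minimizer F S z \<longleftrightarrow> local_minimizer F S z \<and> \<not> global_minimizer F S z"

definition P1_objective ::
  "real^'n^'n \<Rightarrow> real^'n \<Rightarrow> (real^'m \<Rightarrow> real) \<Rightarrow> (real^'n) \<times> (real^'m) \<Rightarrow> real" where
  "P1_objective H c f0 = (\<lambda>(x, y). 1/2 * (x \<bullet> (H *v x)) + c \<bullet> x + f0 y)"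

definition P1_feasible :: "(real^'m \<Rightarrow> real) \<Rightarrow> ((real^'n) \<times> (real^'m)) set" where
  "P1_feasible f = {(x, y). x \<bullet> x + f y \<le> 0}"

definition phi :: "real^'n^'n \<Rightarrow> real^'n \<Rightarrow> real \<Rightarrow> real" where
  "phi H c \<mu> = (norm (matrix_inv (H + \<mu> *\<^sub>R mat 1) *v c))\<^sup>2"

end

theory Submission
  imports Defs
begin

text \<open>The multiplier and second-order conditions are obtained from curves \<open>z + t d + t\<^sup>2 k\<close> along which the
  constraint strictly decreases to second order, so no implicit function argument is needed.
  With the multiplier \<open>\<mu>\<close>, non-globality means that \<open>M = H + \<mu> I\<close> is not positive semidefinite
  (otherwise the Lagrangian would be convex with critical point \<open>(xs, ys)\<close>), i.e. \<open>\<mu> < - \<lambda>\<^sub>1\<close>. The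
  second-order condition makes \<open>M\<close> positive semidefinite on the complement of \<open>xs\<close>; together with a
  circular arc in the plane of the first two eigenvectors this gives \<open>- \<lambda>\<^sub>2 < \<mu>\<close>. Finally
  \<open>\<phi>'(\<mu>) = - 2 xs \<bullet> M\<^sup>-\<^sup>1 xs\<close>, and the bound on \<open>\<phi>'\<close> is the second-order condition for the direction with
  components \<open>M\<^sup>-\<^sup>1 xs\<close> and a multiple of \<open>B\<^sup>-\<^sup>1 g\<close>, where \<open>g\<close> is the gradient of \<open>f\<close> at \<open>ys\<close> and \<open>B\<close> the
  Hessian of \<open>f0 + (\<mu>/2) f\<close> there.\<close>

subsection \<open>Eigenvalues of symmetric matrices\<close>

lemma symmetric_inner_commute:
  fixes A :: "real^'n^'n"
  assumes "transpose A = A"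
  shows "x \<bullet> (A *v y) = y \<bullet> (A *v x)"
  by (metis assms dot_lmul_matrix inner_commute transpose_matrix_vector)

lemma symmetric_quadratic_expand:
  fixes A :: "real^'n^'n"
  assumes "transpose A = A"
  shows "(x + t *\<^sub>R y) \<bullet> (A *v (x + t *\<^sub>R y)) =
    x \<bullet> (A *v x) + 2 * t * (y \<bullet> (A *v x)) + t\<^sup>2 * (y \<bullet> (A *v y))"
  using symmetric_inner_commute[OF assms, of x y]
  by (simp add: matrix_vector_right_distrib matrix_vector_mult_scaleR inner_add_left
      inner_add_right power2_eq_square algebra_simps)

lemma scaled_identity_mult [simp]: "(\<mu> *\<^sub>R mat 1) *v x = \<mu> *\<^sub>R (x :: real^'n)"
  by (simp flip: scaleR_matrix_vector_assoc)

lemma matrix_shift_mult: "(A + \<mu> *\<^sub>R mat 1) *v x = A *v x + \<mu> *\<^sub>R (x :: real^'n)"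
  by (simp add: matrix_vector_mult_add_rdistrib)

lemma mat_mult_vector: "mat t *v x = t *\<^sub>R (x :: real^'n)"
  by (simp add: vec_eq_iff mat_def matrix_vector_mult_def if_distrib[of "\<lambda>a. a * _"] cong: if_cong)

lemma transpose_shift:
  "transpose A = A \<Longrightarrow> transpose (A + \<mu> *\<^sub>R mat 1) = A + \<mu> *\<^sub>R (mat 1 :: real^'n^'n)"
  by (simp add: transpose_def vec_eq_iff mat_def)

text \<open>Near \<open>t = 0\<close> the linear term dominates the square, so a nonzero
  \<open>a\<close> would give a negative value on one side.\<close>

lemma linear_nonneg_quadratic_zero:
  fixes a b :: real
  assumes "\<And>t. 0 \<le> 2 * t * a + t\<^sup>2 * b"
  shows "a = 0"
proof (rule ccontr)
  assume a: "a \<noteq> 0"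
  \<comment> \<open>\<open>c\<close> is a positive upper bound for \<open>b\<close> whatever the
    sign of \<open>b\<close>; \<open>s\<close> then minimizes the majorant
    \<open>2 * s * a + s\<^sup>2 * c\<close>.\<close>
  define c where "c = 1 + \<bar>b\<bar>"
  have c: "c > 0" "b \<le> c"
    by (auto simp: c_def)
  define s where "s = - a / c"
  have "2 * s * a + s\<^sup>2 * b \<le> 2 * s * a + s\<^sup>2 * c"
    using c by (intro add_left_mono mult_left_mono) auto
  also have "\<dots> = - (a\<^sup>2 / c)"
    using c unfolding s_def by (simp add: field_simps power2_eq_square)
  also have "\<dots> < 0"
    using a c by simp
  finally show False
    using assms[of s] by simp
qed

text \<open>A zero of a form that is nonnegative on \<open>S\<close> is a minimum of it there, so
  its first variation vanishes in every direction of \<open>S\<close>.\<close>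

lemma psd_on_zero_quadratic:
  fixes A :: "real^'n^'n"
  assumes sym: "transpose A = A" and S: "subspace S"
    and psd: "\<And>w. w \<in> S \<Longrightarrow> 0 \<le> w \<bullet> (A *v w)"
    and v: "v \<in> S" "v \<bullet> (A *v v) = 0" and w: "w \<in> S"
  shows "w \<bullet> (A *v v) = 0"
proof (rule linear_nonneg_quadratic_zero[where b = "w \<bullet> (A *v w)"])
  fix t :: real
  have "v + t *\<^sub>R w \<in> S"
    using S v w by (simp add: subspace_add subspace_scale)
  from psd[OF this] show "0 \<le> 2 * t * (w \<bullet> (A *v v)) + t\<^sup>2 * (w \<bullet> (A *v w))"
    by (simp add: symmetric_quadratic_expand[OF sym] v)
qed

text \<open>The form attains a minimum \<open>m\<close> on the unit sphere of \<open>S\<close>, at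
  \<open>v\<close>. The form of \<open>A - m I\<close> is then nonnegative on \<open>S\<close> and
  zero at \<open>v\<close>, so \<open>A *v v - m *\<^sub>R v\<close> is orthogonal to
  \<open>S\<close>; lying in \<open>S\<close> by invariance, it is zero.\<close>

lemma symmetric_rayleigh_min:
  fixes A :: "real^'n^'n"
  assumes sym: "transpose A = A" and S: "subspace S" "S \<noteq> {0}"
    and inv: "\<And>v. v \<in> S \<Longrightarrow> A *v v \<in> S"
  obtains v m where "v \<in> S" "norm v = 1" "A *v v = m *\<^sub>R v"
    "\<And>w. w \<in> S \<Longrightarrow> m * (w \<bullet> w) \<le> w \<bullet> (A *v w)"
proof -
  obtain s where s: "s \<in> S" "s \<noteq> 0"
    using S subspace_0 by blast
  have "compact (S \<inter> sphere 0 1)"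
    using S by (simp add: closed_subspace closed_Int_compact)
  moreover have "(1 / norm s) *\<^sub>R s \<in> S \<inter> sphere 0 1"
    using s S by (simp add: subspace_scale)
  moreover have "continuous_on (S \<inter> sphere 0 1) (\<lambda>v. v \<bullet> (A *v v))"
    by (intro continuous_intros matrix_vector_mult_linear_continuous_on)
  ultimately obtain v where v: "v \<in> S" "norm v = 1"
    and vmin: "\<And>w. w \<in> S \<Longrightarrow> norm w = 1 \<Longrightarrow> v \<bullet> (A *v v) \<le> w \<bullet> (A *v w)"
    using continuous_attains_inf[of "S \<inter> sphere 0 1" "\<lambda>v. v \<bullet> (A *v v)"]
    by fastforce
  define m where "m = v \<bullet> (A *v v)"
  have lower: "m * (w \<bullet> w) \<le> w \<bullet> (A *v w)" if w: "w \<in> S" for w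
  proof (cases "w = 0")
    case False
    define u where "u = (1 / norm w) *\<^sub>R w"
    have u: "u \<in> S" "norm u = 1" "w = norm w *\<^sub>R u"
      using False w S by (auto simp: u_def subspace_scale)
    have "w \<bullet> (A *v w) = (norm w)\<^sup>2 * (u \<bullet> (A *v u))"
      by (subst u(3), subst (2) u(3)) (simp add: matrix_vector_mult_scaleR power2_eq_square)
    moreover have "m \<le> u \<bullet> (A *v u)"
      using vmin u by (simp add: m_def)
    ultimately show ?thesis
      by (metis dot_square_norm mult.commute mult_right_mono zero_le_power2)
  qed simp
  define T where "T = A + (- m) *\<^sub>R mat 1"
  have T: "T *v w = A *v w - m *\<^sub>R w" for w
    by (simp only: T_def matrix_shift_mult) simp
  have "w \<bullet> (T *v v) = 0" if "w \<in> S" for w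
  proof (rule psd_on_zero_quadratic[of T S])
    show "transpose T = T"
      unfolding T_def by (rule transpose_shift[OF sym])
    show "v \<bullet> (T *v v) = 0"
      using v by (simp add: T m_def inner_diff_right dot_square_norm)
  qed (use that lower v S in \<open>auto simp: T inner_diff_right\<close>)
  moreover have "T *v v \<in> S"
    using v S inv by (simp add: T subspace_diff subspace_scale)
  ultimately have "T *v v = 0"
    by (metis inner_eq_zero_iff)
  then show ?thesis
    using that[of v m] v lower by (simp add: T)
qed

text \<open>By induction on \<open>k\<close>: the orthogonal complement of the eigenvectors found so
  far is invariant by symmetry, and nontrivial while their number is below the dimension, so the
  Rayleigh minimum there supplies one more.\<close>

lemma symmetric_orthonormal_eigenvectors:
  fixes A :: "real^'n^'n"
  assumes sym: "transpose A = A" and "k \<le> CARD('n)"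
  shows "\<exists>B. finite B \<and> card B = k \<and> pairwise orthogonal B \<and>
    (\<forall>v\<in>B. norm v = 1 \<and> (\<exists>m. A *v v = m *\<^sub>R v))"
  using assms(2)
proof (induction k)
  case 0
  show ?case by (rule exI[of _ "{}"]) auto
next
  case (Suc k)
  then obtain B where B: "finite B" "card B = k" "pairwise orthogonal B"
    and eig: "\<And>v. v \<in> B \<Longrightarrow> norm v = 1 \<and> (\<exists>m. A *v v = m *\<^sub>R v)"
    by auto
  define S where "S = {w. \<forall>v\<in>B. orthogonal v w}"
  have S: "subspace S"
    unfolding S_def subspace_def by (auto simp: orthogonal_clauses)
  have "dim B < DIM(real^'n)"
    using dim_le_card'[OF B(1)] B(2) Suc.prems by simp
  from orthogonal_to_subspace_exists[OF this] obtain s where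
    "s \<noteq> 0" "\<And>w. w \<in> span B \<Longrightarrow> orthogonal s w"
    by blast
  then have "s \<in> S" "s \<noteq> 0"
    by (auto simp: S_def span_base orthogonal_commute)
  then have "S \<noteq> {0}" by auto
  moreover have "A *v w \<in> S" if "w \<in> S" for w
  proof -
    have "v \<bullet> (A *v w) = 0" if "v \<in> B" for v
      using eig[OF that] \<open>w \<in> S\<close> that symmetric_inner_commute[OF sym, of v w]
      by (auto simp: S_def orthogonal_def inner_commute)
    then show ?thesis by (simp add: S_def orthogonal_def)
  qed
  ultimately obtain v m where v: "v \<in> S" "norm v = 1" "A *v v = m *\<^sub>R v"
    using symmetric_rayleigh_min[OF sym S] by metis
  have "v \<notin> B"
    using v by (auto simp: S_def orthogonal_def)
  show ?case
  proof (intro exI conjI)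
    show "pairwise orthogonal (insert v B)"
      using B(3) v(1) by (auto simp: pairwise_insert S_def orthogonal_commute)
  qed (use B v eig \<open>v \<notin> B\<close> in auto)
qed

lemma symmetric_orthonormal_eigenbasis:
  fixes A :: "real^'n^'n"
  assumes "transpose A = A"
  obtains q :: "'n \<Rightarrow> real^'n" and d :: "'n \<Rightarrow> real"
  where "\<And>i j. q i \<bullet> q j = (if i = j then 1 else 0)" "\<And>i. A *v q i = d i *\<^sub>R q i"
proof -
  obtain B :: "(real^'n) set" where B: "finite B" "card B = CARD('n)" "pairwise orthogonal B"
    "\<And>v. v \<in> B \<Longrightarrow> norm v = 1 \<and> (\<exists>m. A *v v = m *\<^sub>R v)"
    using symmetric_orthonormal_eigenvectors[OF assms order_refl] by blast
  obtain q :: "'n \<Rightarrow> real^'n" where q: "bij_betw q UNIV B"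
    using finite_same_card_bij[of "UNIV :: 'n set" B] B by auto
  then have "q i \<in> B" for i
    by (auto simp: bij_betw_def)
  then have "\<exists>m. A *v q i = m *\<^sub>R q i" for i
    using B(4) by blast
  then obtain d where "\<And>i. A *v q i = d i *\<^sub>R q i"
    by metis
  moreover have "q i \<bullet> q j = (if i = j then 1 else 0)" for i j
  proof (cases "i = j")
    case True
    then show ?thesis
      using B(4)[OF \<open>q j \<in> B\<close>] by (simp add: dot_square_norm)
  next
    case False
    then have "q i \<noteq> q j"
      using q by (auto simp: bij_betw_def inj_on_def)
    then show ?thesis
      using B(3) \<open>q i \<in> B\<close> \<open>q j \<in> B\<close> False by (auto simp: pairwise_def orthogonal_def)
  qed
  ultimately show ?thesis
    using that by blast
qed

text \<open>The \<open>q\<close> are the columns of an invertible \<open>Q\<close> with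
  \<open>(t I - A) Q = Q E\<close> and \<open>E\<close> diagonal; taking determinants and cancelling
  \<open>det Q\<close> gives the identity at each \<open>t\<close>.\<close>

lemma charpoly_eigenbasis:
  fixes A :: "real^'n^'n"
  assumes orth: "\<And>i j :: 'n. q i \<bullet> q j = (if i = j then 1 else 0)"
    and eig: "\<And>i. A *v q i = d i *\<^sub>R q i"
  shows "charpoly A = (\<Prod>i\<in>UNIV. [:- d i, 1:])"
proof (rule poly_ext)
  fix t
  define Q :: "real^'n^'n" where "Q = (\<chi> i j. q j $ i)"
  define E :: "real^'n^'n" where "E = (\<chi> i j. if i = j then t - d i else 0)"
  have "transpose Q ** Q = mat 1"
    using orth by (simp add: Q_def matrix_matrix_mult_def transpose_def vec_eq_iff mat_def
        inner_vec_def)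
  then have "det (transpose Q) * det Q = 1"
    by (metis det_I det_mul)
  then have Q: "det Q \<noteq> 0" by auto
  have "((mat t - A) ** Q) $ i $ j = (Q ** E) $ i $ j" for i j
  proof -
    have "((mat t - A) ** Q) $ i $ j = ((mat t - A) *v q j) $ i"
      by (simp add: matrix_matrix_mult_def matrix_vector_mult_def Q_def)
    also have "\<dots> = (t - d j) * q j $ i"
      by (simp add: matrix_vector_mult_diff_rdistrib mat_mult_vector eig algebra_simps)
    also have "\<dots> = (Q ** E) $ i $ j"
      by (simp add: Q_def E_def matrix_matrix_mult_def if_distrib[of "\<lambda>x. _ * x"] cong: if_cong)
    finally show ?thesis .
  qed
  then have "(mat t - A) ** Q = Q ** E"
    by (simp add: vec_eq_iff)
  then have "det (mat t - A) * det Q = det Q * det E"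
    by (metis det_mul)
  then have "det (mat t - A) = det E"
    using Q by simp
  also have "\<dots> = (\<Prod>i\<in>UNIV. t - d i)"
    by (subst det_diagonal) (auto simp: E_def)
  finally show "poly (charpoly A) t = poly (\<Prod>i\<in>UNIV. [:- d i, 1:]) t"
    by (simp add: poly_charpoly poly_prod)
qed

text \<open>Connects \<open>eigval\<close>, which is read off the characteristic polynomial, with
  eigenvectors. The two vectors are orthogonal even when the two values coincide, since they belong
  to different indices of an orthonormal basis.\<close>

lemma eigval_structure:
  fixes A :: "real^'n^'n"
  assumes sym: "transpose A = A" and n: "CARD('n) \<ge> 2"
  obtains v1 v2 where "norm v1 = 1" "norm v2 = 1" "v1 \<bullet> v2 = 0"
    "A *v v1 = eigval A 1 *\<^sub>R v1" "A *v v2 = eigval A 2 *\<^sub>R v2"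
    "\<And>v. eigval A 1 * (v \<bullet> v) \<le> v \<bullet> (A *v v)"
    "\<And>t. eigval A 1 < t \<Longrightarrow> t < eigval A 2 \<Longrightarrow> det (mat t - A) \<noteq> 0"
proof -
  obtain q d where orth: "\<And>i j :: 'n. q i \<bullet> q j = (if i = j then 1 else 0)"
    and eig: "\<And>i. A *v q i = d i *\<^sub>R q i"
    using symmetric_orthonormal_eigenbasis[OF sym] by blast
  obtain us :: "'n list" where us: "set us = UNIV" "distinct us"
    using finite_distinct_list[of "UNIV :: 'n set"] by auto
  \<comment> \<open>Sorting the indices instead of the values keeps an eigenvector attached to each
    entry of \<open>L\<close>; the first two eigenvalues sit at positions 0 and 1.\<close>
  define ns where "ns = sort_key d us"
  define L where "L = map d ns"
  have ns: "distinct ns" "length ns = CARD('n)"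
    using us distinct_card[of us] by (auto simp: ns_def)
  have "mset us = mset_set UNIV"
    using us mset_set_set by metis
  then have "proots (charpoly A) = mset L"
    by (simp add: charpoly_eigenbasis[OF orth eig] proots_prod L_def ns_def
        sum_unfold_sum_mset)
  then have sorted_roots: "sorted_list_of_multiset (proots (charpoly A)) = L"
    by (metis sorted_list_of_multiset_mset sorted_sort_id sorted_sort_key L_def ns_def)
  then have eL: "eigval A 1 = L ! 0" "eigval A 2 = L ! 1"
    by (simp_all add: eigval_def)
  have sL: "sorted L" "length L = CARD('n)"
    using ns by (auto simp: L_def ns_def)
  have root: "t \<in> set L" if "det (mat t - A) = 0" for t
  proof -
    have "charpoly A \<noteq> 0"
      by (simp add: charpoly_eigenbasis[OF orth eig])
    then have "t \<in># proots (charpoly A)"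
      using that by (simp add: poly_charpoly)
    then show ?thesis
      using \<open>proots (charpoly A) = mset L\<close> by simp
  qed
  have first: "L ! 0 \<le> t" if "t \<in> set L" for t
    using that sL n by (metis in_set_conv_nth le0 sorted_nth_mono)
  show ?thesis
  proof (rule that)
    show "norm (q (ns ! 0)) = 1" "norm (q (ns ! 1)) = 1"
      using orth by (simp_all add: norm_eq_1)
    have "ns ! 0 \<noteq> ns ! 1"
      using ns n by (simp add: nth_eq_iff_index_eq)
    then show "q (ns ! 0) \<bullet> q (ns ! 1) = 0"
      using orth by simp
    show "A *v q (ns ! 0) = eigval A 1 *\<^sub>R q (ns ! 0)"
      "A *v q (ns ! 1) = eigval A 2 *\<^sub>R q (ns ! 1)"
      unfolding eL L_def using eig n ns by simp_all
    show "eigval A 1 * (v \<bullet> v) \<le> v \<bullet> (A *v v)" for v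
    proof -
      \<comment> \<open>The minimum of the Rayleigh quotient over the whole space is itself an
        eigenvalue, hence at least the first entry of \<open>L\<close>.\<close>
      have "(UNIV :: (real^'n) set) \<noteq> {0}"
        using UNIV_not_singleton by blast
      then obtain u m where u: "norm u = 1" "A *v u = m *\<^sub>R u"
        and m: "\<And>w. m * (w \<bullet> w) \<le> w \<bullet> (A *v w)"
        using symmetric_rayleigh_min[OF sym subspace_UNIV] by (metis UNIV_I)
      have "(mat m - A) *v u = 0"
        using u by (simp add: matrix_vector_mult_diff_rdistrib mat_mult_vector)
      then have "det (mat m - A) = 0"
        using u by (metis invertible_det_nz matrix_left_invertible_ker invertible_left_inverse
            norm_zero zero_neq_one)
      then have "L ! 0 \<le> m"
        using root first by blast
      then show ?thesis
        using m[of v] by (metis eL(1) inner_ge_zero mult_right_mono order_trans)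
    qed
    show "det (mat t - A) \<noteq> 0" if t: "eigval A 1 < t" "t < eigval A 2" for t
    proof
      assume "det (mat t - A) = 0"
      then obtain i where i: "i < length L" "L ! i = t"
        using root by (meson in_set_conv_nth)
      show False
      proof (cases i)
        case 0
        then show ?thesis using i t eL by simp
      next
        case (Suc j)
        then have "L ! 1 \<le> L ! i"
          using sL i by (intro sorted_nth_mono) auto
        then show ?thesis using i t eL by simp
      qed
    qed
  qed
qed

subsection \<open>Gradients and Hessians\<close>

text \<open>The derivative, being linear, is represented by the vector \<open>adjoint f' 1\<close>;
  uniqueness of this vector makes the description in \<open>grad\<close> denote it.\<close>

lemma GDERIV_grad:
  fixes f :: "'a::euclidean_space \<Rightarrow> real"
  assumes "f differentiable (at x)"
  shows "GDERIV f x :> grad f x"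
proof -
  obtain f' where f': "(f has_derivative f') (at x)"
    using assms by (auto simp: differentiable_def)
  then have "linear f'"
    by (rule has_derivative_linear)
  then have "f' = (\<lambda>h. h \<bullet> adjoint f' 1)"
    by (simp add: adjoint_works fun_eq_iff)
  with f' have D: "GDERIV f x :> adjoint f' 1"
    by (simp add: gderiv_def)
  show ?thesis
    unfolding grad_def
  proof (rule theI)
    show "GDERIV f x :> adjoint f' 1" by (rule D)
  next
    fix D' assume "GDERIV f x :> D'"
    with D have "(\<lambda>h. h \<bullet> D') = (\<lambda>h. h \<bullet> adjoint f' 1)"
      unfolding gderiv_def by (rule has_derivative_unique[rotated])
    then show "D' = adjoint f' 1"
      by (metis vector_eq_ldot)
  qed
qed

lemma C2_GDERIV: "C2 f \<Longrightarrow> GDERIV f x :> grad f x"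
  by (simp add: C2_def GDERIV_grad)

lemma C2_grad_has_derivative:
  assumes "C2 f"
  shows "(grad f has_derivative (\<lambda>h. hess f x *v h)) (at x)"
proof -
  have D: "(grad f has_derivative frechet_derivative (grad f) (at x)) (at x)"
    using assms by (simp add: C2_def flip: frechet_derivative_works)
  moreover have "frechet_derivative (grad f) (at x) = (\<lambda>h. hess f x *v h)"
    using has_derivative_linear[OF D] by (simp add: hess_def matrix_works linear_matrix_vector_mul_eq)
  ultimately show ?thesis by simp
qed

text \<open>Restriction to the line through \<open>a\<close> and \<open>b\<close> reduces the claim
  to the tangent inequality for convex functions of one real variable.\<close>

lemma convex_above_tangent:
  fixes f :: "'a::real_inner \<Rightarrow> real"
  assumes f: "convex_on UNIV f" and D: "GDERIV f a :> D"
  shows "f a + D \<bullet> (b - a) \<le> f b"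
proof -
  have "convex_on UNIV (\<lambda>t. f (a + t *\<^sub>R (b - a)))"
  proof (rule convex_onI)
    fix t x y :: real assume t: "0 < t" "t < 1"
    have "a + ((1 - t) *\<^sub>R x + t *\<^sub>R y) *\<^sub>R (b - a) =
        (1 - t) *\<^sub>R (a + x *\<^sub>R (b - a)) + t *\<^sub>R (a + y *\<^sub>R (b - a))"
      by (simp add: algebra_simps)
    then show "f (a + ((1 - t) *\<^sub>R x + t *\<^sub>R y) *\<^sub>R (b - a)) \<le>
        (1 - t) * f (a + x *\<^sub>R (b - a)) + t * f (a + y *\<^sub>R (b - a))"
      using convex_onD[OF f, of t] t by simp
  qed simp
  moreover have "((\<lambda>t. f (a + t *\<^sub>R (b - a))) has_field_derivative D \<bullet> (b - a)) (at 0 within UNIV)"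
  proof -
    have "((\<lambda>t. a + t *\<^sub>R (b - a)) has_derivative (\<lambda>t. t *\<^sub>R (b - a))) (at 0)"
      by (auto intro!: derivative_eq_intros)
    moreover have "(f has_derivative (\<lambda>h. h \<bullet> D)) (at (a + 0 *\<^sub>R (b - a)))"
      using D by (simp add: gderiv_def)
    ultimately have "((\<lambda>t. f (a + t *\<^sub>R (b - a))) has_derivative (\<lambda>t. (t *\<^sub>R (b - a)) \<bullet> D)) (at 0)"
      by (rule has_derivative_compose)
    then show ?thesis
      by (simp add: has_field_derivative_def inner_commute mult_commute_abs)
  qed
  ultimately have "(D \<bullet> (b - a)) * (1 - 0) \<le> f (a + 1 *\<^sub>R (b - a)) - f (a + 0 *\<^sub>R (b - a))"
    by (intro convex_on_imp_above_tangent[where A = UNIV]) auto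
  then show ?thesis by simp
qed

lemma curve_derivative:
  assumes "\<And>z. GDERIV F z :> F' z"
  shows "((\<lambda>t. F (z + t *\<^sub>R d + t\<^sup>2 *\<^sub>R k)) has_real_derivative
    F' (z + t *\<^sub>R d + t\<^sup>2 *\<^sub>R k) \<bullet> (d + (2 * t) *\<^sub>R k)) (at t)"
proof -
  have "((\<lambda>t. z + t *\<^sub>R d + t\<^sup>2 *\<^sub>R k) has_derivative (\<lambda>h. h *\<^sub>R (d + (2 * t) *\<^sub>R k))) (at t)"
    by (auto intro!: derivative_eq_intros simp: algebra_simps)
  from has_derivative_compose[OF this assms[unfolded gderiv_def]] show ?thesis
    by (simp add: has_field_derivative_def inner_commute mult_commute_abs)
qed

text \<open>Two contributions at \<open>t = 0\<close>: the gradient changes at rate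
  \<open>F'' d\<close> and is paired with the velocity \<open>d\<close>; the velocity changes at
  rate \<open>2 k\<close> and is paired with \<open>F' z\<close>.\<close>

lemma curve_second_derivative:
  assumes "(F' has_derivative F'') (at z)"
  shows "((\<lambda>t. F' (z + t *\<^sub>R d + t\<^sup>2 *\<^sub>R k) \<bullet> (d + (2 * t) *\<^sub>R k)) has_real_derivative
    F'' d \<bullet> d + 2 * (F' z \<bullet> k)) (at 0)"
proof -
  have "((\<lambda>t. z + t *\<^sub>R d + t\<^sup>2 *\<^sub>R k) has_derivative (\<lambda>h. h *\<^sub>R d)) (at 0)"
    by (auto intro!: derivative_eq_intros simp: algebra_simps)
  moreover have "(F' has_derivative F'') (at (z + 0 *\<^sub>R d + 0\<^sup>2 *\<^sub>R k))"
    using assms by simp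
  ultimately have "((\<lambda>t. F' (z + t *\<^sub>R d + t\<^sup>2 *\<^sub>R k)) has_derivative (\<lambda>h. F'' (h *\<^sub>R d))) (at 0)"
    by (rule has_derivative_compose)
  moreover have "F'' (h *\<^sub>R d) = h *\<^sub>R F'' d" for h
    using has_derivative_linear[OF assms] by (simp add: linear_cmul)
  moreover have "((\<lambda>t. d + (2 * t) *\<^sub>R k) has_derivative (\<lambda>h. h *\<^sub>R (2 *\<^sub>R k))) (at 0)"
    by (auto intro!: derivative_eq_intros simp: algebra_simps)
  ultimately have "((\<lambda>t. F' (z + t *\<^sub>R d + t\<^sup>2 *\<^sub>R k) \<bullet> (d + (2 * t) *\<^sub>R k)) has_derivative
      (\<lambda>h. F' (z + 0 *\<^sub>R d + 0\<^sup>2 *\<^sub>R k) \<bullet> (h *\<^sub>R (2 *\<^sub>R k)) + h *\<^sub>R F'' d \<bullet> (d + (2 * 0) *\<^sub>R k))) (at 0)"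
    by (intro has_derivative_inner) auto
  then show ?thesis
    unfolding has_field_derivative_def
    by (rule has_derivative_eq_rhs) (simp add: fun_eq_iff algebra_simps)
qed

subsection \<open>Optimality conditions for one inequality constraint\<close>

lemma eventually_decreasing_right:
  fixes p :: "real \<Rightarrow> real"
  assumes "DERIV p 0 :> l" "l < 0"
  shows "\<forall>\<^sub>F t in at_right 0. p t < p 0"
  using DERIV_neg_dec_right[OF assms] unfolding eventually_at_right_field by auto

text \<open>Starting from 0 with negative slope, \<open>p'\<close> is negative just to the right of
  0, so \<open>p\<close> strictly decreases there.\<close>

lemma eventually_decreasing_right2:
  fixes p :: "real \<Rightarrow> real"
  assumes p: "\<And>t. DERIV p t :> p' t" and "p' 0 = 0" and "DERIV p' 0 :> l" "l < 0"
  shows "\<forall>\<^sub>F t in at_right 0. p t < p 0"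
proof -
  obtain e where e: "e > 0" "\<And>t. 0 < t \<Longrightarrow> t < e \<Longrightarrow> p' t < 0"
    using DERIV_neg_dec_right[OF assms(3,4)] assms(2) by auto
  have "p t < p 0" if "0 < t" "t < e" for t
  proof (rule DERIV_neg_imp_decreasing_open[OF that(1)])
    show "\<exists>y. DERIV p s :> y \<and> y < 0" if "0 < s" "s < t" for s
      using p[of s] e(2)[of s] that \<open>t < e\<close> by auto
    show "continuous_on {0..t} p"
      using p by (meson DERIV_continuous_on has_field_derivative_at_within)
  qed
  then show ?thesis
    unfolding eventually_at_right_field using e(1) by auto
qed

text \<open>The curve tends to \<open>z\<close>, so small \<open>t > 0\<close> would give feasible
  points of smaller value inside the ball of minimality.\<close>

lemma local_minimizer_curve:
  fixes F :: "'a::real_normed_vector \<Rightarrow> real"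
  assumes "local_minimizer F S z"
    and "\<forall>\<^sub>F t in at_right 0. z + t *\<^sub>R d + t\<^sup>2 *\<^sub>R k \<in> S"
  shows "\<not> (\<forall>\<^sub>F t in at_right 0. F (z + t *\<^sub>R d + t\<^sup>2 *\<^sub>R k) < F z)"
proof
  assume less: "\<forall>\<^sub>F t in at_right 0. F (z + t *\<^sub>R d + t\<^sup>2 *\<^sub>R k) < F z"
  obtain e where e: "e > 0" "\<And>w. w \<in> S \<Longrightarrow> dist w z < e \<Longrightarrow> F z \<le> F w"
    using assms(1) by (auto simp: local_minimizer_def)
  have "((\<lambda>t. z + t *\<^sub>R d + t\<^sup>2 *\<^sub>R k) \<longlongrightarrow> z + 0 *\<^sub>R d + 0\<^sup>2 *\<^sub>R k) (at_right 0)"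
    by (intro tendsto_intros)
  then have "\<forall>\<^sub>F t in at_right 0. dist (z + t *\<^sub>R d + t\<^sup>2 *\<^sub>R k) z < e"
    using e(1) by (auto dest: tendstoD)
  with less assms(2) have "\<forall>\<^sub>F t in at_right (0::real). False"
    by eventually_elim (use e(2) in fastforce)
  then show False by simp
qed

text \<open>Second derivatives are maps here because the application is to pairs
  \<open>(x, y)\<close>, whereas \<open>hess\<close> is a matrix for functions of a vector.\<close>

locale constrained_minimizer =
  fixes F G :: "'a::real_inner \<Rightarrow> real" and F' G' F'' G'' :: "'a \<Rightarrow> 'a" and z :: 'a
  assumes minimizer: "local_minimizer F {z. G z \<le> 0} z"
    and F': "\<And>z. GDERIV F z :> F' z" and F'': "(F' has_derivative F'') (at z)"
    and G': "\<And>z. GDERIV G z :> G' z" and G'': "(G' has_derivative G'') (at z)"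
begin

lemma feasible: "G z \<le> 0"
  using minimizer by (simp add: local_minimizer_def)

text \<open>The cases are an inactive constraint, a first-order decrease, and a tangent direction
  with a second-order decrease; in the last, the correction \<open>k\<close> bends the curve into
  the feasible set.\<close>

lemma eventually_feasible:
  assumes "G z < 0 \<or> G' z \<bullet> d < 0 \<or> G' z \<bullet> d = 0 \<and> G'' d \<bullet> d + 2 * (G' z \<bullet> k) < 0"
  shows "\<forall>\<^sub>F t in at_right 0. z + t *\<^sub>R d + t\<^sup>2 *\<^sub>R k \<in> {z. G z \<le> 0}"
proof -
  let ?p = "\<lambda>t. G (z + t *\<^sub>R d + t\<^sup>2 *\<^sub>R k)"
  note D = curve_derivative[of G G' z d k, OF G']
  from assms consider "G z < 0" | "G' z \<bullet> d < 0"
    | "G' z \<bullet> d = 0" "G'' d \<bullet> d + 2 * (G' z \<bullet> k) < 0" by blast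
  then have "\<forall>\<^sub>F t in at_right 0. ?p t \<le> 0"
  proof cases
    case 1
    have "isCont ?p 0"
      using D by (rule DERIV_isCont)
    then have "(?p \<longlongrightarrow> ?p 0) (at_right 0)"
      by (auto simp: isCont_def intro: filterlim_at_split[THEN iffD1, THEN conjunct2])
    then have "\<forall>\<^sub>F t in at_right 0. ?p t < 0"
      using 1 by (auto dest: order_tendstoD)
    then show ?thesis by (rule eventually_mono) auto
  next
    case 2
    have "\<forall>\<^sub>F t in at_right 0. ?p t < ?p 0"
      using D[of 0] 2 by (intro eventually_decreasing_right) auto
    then show ?thesis by (rule eventually_mono) (use feasible in auto)
  next
    case 3
    have "\<forall>\<^sub>F t in at_right 0. ?p t < ?p 0"
      by (rule eventually_decreasing_right2[OF D _ curve_second_derivative[OF G'']])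
        (use 3 in auto)
    then show ?thesis by (rule eventually_mono) (use feasible in auto)
  qed
  then show ?thesis by simp
qed

lemma first_order:
  assumes "G z < 0 \<or> G' z \<bullet> d < 0"
  shows "0 \<le> F' z \<bullet> d"
proof (rule ccontr)
  let ?p = "\<lambda>t. F (z + t *\<^sub>R d + t\<^sup>2 *\<^sub>R 0)"
  assume "\<not> 0 \<le> F' z \<bullet> d"
  then have "\<forall>\<^sub>F t in at_right 0. ?p t < ?p 0"
    using curve_derivative[of F F' z d 0 0, OF F'] by (intro eventually_decreasing_right) auto
  then show False
    using local_minimizer_curve[OF minimizer eventually_feasible, of d 0] assms by auto
qed

lemma second_order:
  assumes "G z < 0 \<or> G' z \<bullet> d < 0 \<or> G' z \<bullet> d = 0 \<and> G'' d \<bullet> d + 2 * (G' z \<bullet> k) < 0"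
    and "F' z \<bullet> d = 0"
  shows "0 \<le> F'' d \<bullet> d + 2 * (F' z \<bullet> k)"
proof (rule ccontr)
  let ?p = "\<lambda>t. F (z + t *\<^sub>R d + t\<^sup>2 *\<^sub>R k)"
  assume "\<not> 0 \<le> F'' d \<bullet> d + 2 * (F' z \<bullet> k)"
  then have "\<forall>\<^sub>F t in at_right 0. ?p t < ?p 0"
    using assms(2)
    by (intro eventually_decreasing_right2[OF curve_derivative[of F F' z d k, OF F'] _
          curve_second_derivative[OF F'']]) auto
  then show False
    using local_minimizer_curve[OF minimizer eventually_feasible, of d k] assms(1) by simp
qed

lemma inactive_gradient: "G z < 0 \<Longrightarrow> F' z = 0"
  using first_order[of "- F' z"] inner_ge_zero[of "F' z"] by (simp add: antisym)

lemma inactive: "G z < 0 \<Longrightarrow> 0 \<le> F'' d \<bullet> d"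
  using second_order[of d 0] inactive_gradient by simp

text \<open>In the active case \<open>m\<close> makes the residual \<open>r\<close> orthogonal to
  \<open>G' z\<close>. The direction \<open>- G' z\<close> gives \<open>m \<ge> 0\<close>; the
  direction \<open>- r\<close>, tilted slightly inward, gives \<open>r = 0\<close>.\<close>

lemma multiplier:
  assumes n: "G' z \<noteq> 0"
  obtains m where "m \<ge> 0" "F' z = - m *\<^sub>R G' z"
proof (cases "G z < 0")
  case True
  then show ?thesis using that[of 0] inactive_gradient by simp
next
  case False
  define N where "N = G' z \<bullet> G' z"
  define m where "m = - (F' z \<bullet> G' z) / N"
  define r where "r = F' z + m *\<^sub>R G' z"
  have N: "N > 0" using n by (simp add: N_def)
  have rn: "G' z \<bullet> r = 0"
    using N by (simp add: r_def inner_diff_right m_def inner_commute flip: N_def)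
  have Fr: "F' z \<bullet> r = r \<bullet> r"
    using rn by (subst (2) r_def) (simp add: inner_add_left)
  have "0 \<le> m * N"
    using first_order[of "- G' z"] N by (simp add: m_def N_def)
  then have m: "m \<ge> 0" using N by (simp add: zero_le_mult_iff)
  \<comment> \<open>Since \<open>- r\<close> is only tangent, the term
    \<open>- e *\<^sub>R G' z\<close> is added to make the constraint strictly decrease;
    \<open>e\<close> is arbitrarily small.\<close>
  have step: "r \<bullet> r \<le> e * (m * N)" if "e > 0" for e
    using first_order[of "- r - e *\<^sub>R G' z"] that N rn Fr
    by (simp add: inner_diff_right m_def N_def)
  have "r \<bullet> r \<le> 0"
  proof (rule field_le_epsilon)
    fix e :: real assume "e > 0"
    have "e / (1 + m * N) * (m * N) \<le> e"
      using \<open>e > 0\<close> \<open>0 \<le> m * N\<close> by (simp add: field_simps)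
    with step[of "e / (1 + m * N)"] \<open>e > 0\<close> \<open>0 \<le> m * N\<close> show "r \<bullet> r \<le> 0 + e"
      by (simp add: add_pos_nonneg)
  qed
  then have "r = 0"
    using inner_ge_zero[of r] by (simp add: antisym)
  then show ?thesis
    using that[OF m] by (simp add: r_def add_eq_0_iff)
qed

text \<open>With \<open>k\<close> along \<open>G' z\<close>, the second-order change of the
  constraint is set to \<open>- s < 0\<close>. The same \<open>k\<close> then contributes
  \<open>m * (G'' d \<bullet> d + s)\<close> to the objective, which leaves the Lagrangian form up
  to the error \<open>m * s\<close>.\<close>

lemma second_order_lagrangian:
  assumes m: "m \<ge> 0" "F' z = - m *\<^sub>R G' z" and n: "G' z \<noteq> 0" and d: "G' z \<bullet> d = 0"
  shows "0 \<le> F'' d \<bullet> d + m * (G'' d \<bullet> d)"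
proof (rule field_le_epsilon)
  fix e :: real assume e: "e > 0"
  define N where "N = G' z \<bullet> G' z"
  \<comment> \<open>Dividing by \<open>1 + m\<close> instead of \<open>m\<close> gives
    \<open>m * s \<le> e\<close> in the case \<open>m = 0\<close> too.\<close>
  define s where "s = e / (1 + m)"
  define k where "k = (- (G'' d \<bullet> d + s) / (2 * N)) *\<^sub>R G' z"
  have N: "N > 0" using n by (simp add: N_def)
  have s: "s > 0" "m * s \<le> e" using e m by (auto simp: s_def field_simps)
  have k: "2 * (G' z \<bullet> k) = - (G'' d \<bullet> d + s)"
    using N by (simp add: k_def flip: N_def)
  have "0 \<le> F'' d \<bullet> d + 2 * (F' z \<bullet> k)"
    using d s k m by (intro second_order) auto
  also have "2 * (F' z \<bullet> k) = - m * (2 * (G' z \<bullet> k))"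
    by (simp add: m)
  finally show "0 \<le> F'' d \<bullet> d + m * (G'' d \<bullet> d) + e"
    using s unfolding k by (simp add: algebra_simps)
qed

text \<open>When \<open>F' z = 0\<close>, every direction of strict constraint decrease is
  admissible with \<open>k = 0\<close>. Tilting by \<open>- s *\<^sub>R G' z\<close> and letting
  \<open>s\<close> tend to 0 covers the closed half-space, and the form is even in
  \<open>d\<close>.\<close>

lemma second_order_zero_multiplier:
  assumes F: "F' z = 0" and n: "G' z \<noteq> 0"
  shows "0 \<le> F'' d \<bullet> d"
proof -
  have *: "0 \<le> F'' d \<bullet> d" if d: "G' z \<bullet> d \<le> 0" for d
  proof -
    define p where "p s = F'' (d - s *\<^sub>R G' z) \<bullet> (d - s *\<^sub>R G' z)" for s
    have "p s = F'' d \<bullet> d - s * (F'' d \<bullet> G' z + F'' (G' z) \<bullet> d) + s\<^sup>2 * (F'' (G' z) \<bullet> G' z)" for s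
      using has_derivative_linear[OF F'']
      by (simp add: p_def linear_diff linear_cmul inner_diff_left inner_diff_right
          power2_eq_square algebra_simps)
    then have "p = (\<lambda>s. F'' d \<bullet> d - s * (F'' d \<bullet> G' z + F'' (G' z) \<bullet> d) + s\<^sup>2 * (F'' (G' z) \<bullet> G' z))"
      by auto
    moreover have "((\<lambda>s. F'' d \<bullet> d - s * (F'' d \<bullet> G' z + F'' (G' z) \<bullet> d) + s\<^sup>2 * (F'' (G' z) \<bullet> G' z))
      \<longlongrightarrow> F'' d \<bullet> d - 0 * (F'' d \<bullet> G' z + F'' (G' z) \<bullet> d) + 0\<^sup>2 * (F'' (G' z) \<bullet> G' z)) (at_right 0)"
      by (intro tendsto_intros)
    ultimately have "(p \<longlongrightarrow> F'' d \<bullet> d) (at_right 0)" by simp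
    moreover have "\<forall>\<^sub>F s in at_right 0. 0 \<le> p s"
      unfolding eventually_at_right_field
    proof (intro exI[of _ 1] conjI allI impI)
      fix s :: real assume "0 < s"
      moreover have "0 < G' z \<bullet> G' z" using n by simp
      ultimately have "0 < s * (G' z \<bullet> G' z)" by (rule mult_pos_pos)
      then have "G' z \<bullet> (d - s *\<^sub>R G' z) < 0"
        using d by (simp add: inner_diff_right)
      then show "0 \<le> p s"
        using second_order[of "d - s *\<^sub>R G' z" 0] F by (simp add: p_def)
    qed simp
    ultimately show ?thesis
      by (rule tendsto_lowerbound) simp
  qed
  show ?thesis
  proof (cases "G' z \<bullet> d \<le> 0")
    case False
    then have "0 \<le> F'' (- d) \<bullet> (- d)" by (intro *) simp
    then show ?thesis
      using has_derivative_linear[OF F''] by (simp add: linear_neg)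
  qed (rule *)
qed

end

subsection \<open>Local minimizers of (P1)\<close>

text \<open>Subtracting the tangent from \<open>f\<close> along a line leaves a function minimal at
  0 with zero slope there; a negative second derivative would make it decrease.\<close>

lemma convex_hess_nonneg:
  assumes f: "convex_on UNIV f" "C2 f"
  shows "0 \<le> w \<bullet> (hess f y *v w)"
proof (rule ccontr)
  assume neg: "\<not> 0 \<le> w \<bullet> (hess f y *v w)"
  define p where "p t = f (y + t *\<^sub>R w + t\<^sup>2 *\<^sub>R 0) - t * (grad f y \<bullet> w)" for t
  define p' where "p' t = grad f (y + t *\<^sub>R w + t\<^sup>2 *\<^sub>R 0) \<bullet> (w + (2 * t) *\<^sub>R 0) - grad f y \<bullet> w" for t
  have "DERIV p t :> p' t" for t
    unfolding p_def p'_def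
    by (rule derivative_eq_intros curve_derivative[of f "grad f" y w 0, OF C2_GDERIV[OF f(2)]] refl)+ simp
  moreover have "DERIV p' 0 :> (hess f y *v w) \<bullet> w + 2 * (grad f y \<bullet> 0) - 0"
    unfolding p'_def
    by (rule derivative_intros curve_second_derivative C2_grad_has_derivative f)+
  ultimately have "\<forall>\<^sub>F t in at_right 0. p t < p 0"
    using neg by (intro eventually_decreasing_right2[of p p']) (auto simp: p'_def inner_commute)
  moreover have "p 0 \<le> p t" for t
    using convex_above_tangent[OF f(1) C2_GDERIV[OF f(2)], of y "y + t *\<^sub>R w"] by (simp add: p_def)
  ultimately have "\<forall>\<^sub>F t in at_right (0::real). False"
    by (auto elim!: eventually_mono simp: not_less[symmetric])
  then show False by simp
qed

lemma P1_constrained_minimizer: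
  fixes H :: "real^'n^'n" and f0 f :: "real^'m \<Rightarrow> real"
  assumes sym: "transpose H = H" and C2: "C2 f0" "C2 f"
    and min: "local_minimizer (P1_objective H c f0) (P1_feasible f) (xs, ys)"
  shows "constrained_minimizer (P1_objective H c f0) (\<lambda>(x, y). x \<bullet> x + f y)
    (\<lambda>(x, y). (H *v x + c, grad f0 y)) (\<lambda>(x, y). (2 *\<^sub>R x, grad f y))
    (\<lambda>(u, w). (H *v u, hess f0 ys *v w)) (\<lambda>(u, w). (2 *\<^sub>R u, hess f ys *v w)) (xs, ys)"
proof
  have "(P1_feasible f :: ((real^'n) \<times> (real^'m)) set) = {z. (case z of (x, y) \<Rightarrow> x \<bullet> x + f y) \<le> 0}"
    by (auto simp: P1_feasible_def)
  with min show "local_minimizer (P1_objective H c f0) {z. (case z of (x, y) \<Rightarrow> x \<bullet> x + f y) \<le> 0} (xs, ys)"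
    by simp
  have snd: "((\<lambda>z. g (snd z)) has_derivative (\<lambda>h. snd h \<bullet> grad g (snd z))) (at z)"
    if "C2 g" for g :: "real^'m \<Rightarrow> real" and z :: "(real^'n) \<times> (real^'m)"
    by (rule has_derivative_compose[OF bounded_linear_imp_has_derivative[OF bounded_linear_snd]
          C2_GDERIV[OF that, unfolded gderiv_def]])
  have fst: "(fst has_derivative fst) (at z)" for z :: "(real^'n) \<times> (real^'m)"
    by (rule bounded_linear_imp_has_derivative[OF bounded_linear_fst])
  have H: "((\<lambda>z. H *v fst z) has_derivative (\<lambda>h. H *v fst h)) (at z)" for z :: "(real^'n) \<times> (real^'m)"
    by (intro bounded_linear.has_derivative[OF matrix_vector_mul_bounded_linear] derivative_intros)
  have grad: "((\<lambda>z. grad g (snd z)) has_derivative (\<lambda>h. hess g ys *v snd h)) (at (xs, ys))"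
    if "C2 g" for g :: "real^'m \<Rightarrow> real"
    by (rule has_derivative_compose[OF bounded_linear_imp_has_derivative[OF bounded_linear_snd]])
      (simp add: C2_grad_has_derivative that)
  show "GDERIV (P1_objective H c f0) z :> (case z of (x, y) \<Rightarrow> (H *v x + c, grad f0 y))" for z
    unfolding gderiv_def P1_objective_def case_prod_beta
    by (rule derivative_eq_intros H snd[OF C2(1)] refl)+
      (auto simp: fun_eq_iff inner_prod_def inner_add_right inner_commute[of c]
        symmetric_inner_commute[OF sym, of "fst z"])
  show "GDERIV (\<lambda>(x, y). x \<bullet> x + f y) z :> (case z of (x, y) \<Rightarrow> (2 *\<^sub>R x, grad f y))"
    for z :: "(real^'n) \<times> (real^'m)"
  proof -
    have "((\<lambda>z. fst z \<bullet> fst z + f (snd z)) has_derivative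
        (\<lambda>h. (fst z \<bullet> fst h + fst h \<bullet> fst z) + snd h \<bullet> grad f (snd z))) (at z)"
      by (intro has_derivative_add has_derivative_inner fst snd C2)
    moreover have "(fst z \<bullet> fst h + fst h \<bullet> fst z) + snd h \<bullet> grad f (snd z) =
        h \<bullet> (2 *\<^sub>R fst z, grad f (snd z))" for h
      by (simp add: inner_prod_def inner_commute)
    ultimately show ?thesis
      unfolding gderiv_def case_prod_beta by (simp only:)
  qed
  show "((\<lambda>(x, y). (H *v x + c, grad f0 y)) has_derivative (\<lambda>(u, w). (H *v u, hess f0 ys *v w))) (at (xs, ys))"
    unfolding case_prod_beta
    by (rule has_derivative_Pair[OF has_derivative_add_const[OF H] grad[OF C2(1)]])
  show "((\<lambda>(x, y). (2 *\<^sub>R x, grad f y)) has_derivative (\<lambda>(u, w). (2 *\<^sub>R u, hess f ys *v w))) (at (xs, ys))"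
    unfolding case_prod_beta
    by (rule has_derivative_Pair[OF has_derivative_scaleR_right[OF fst] grad[OF C2(2)]])
qed

text \<open>A direction \<open>v\<close> of negative curvature of \<open>H\<close> rules out both an
  inactive constraint and a zero multiplier; convexity and the Slater point give a nonzero
  constraint gradient.\<close>

lemma P1_necessary_conditions:
  fixes H :: "real^'n^'n" and f0 f :: "real^'m \<Rightarrow> real"
  assumes sym: "transpose H = H" and npsd: "\<not> psd H" and C2: "C2 f0" "C2 f"
    and conv: "convex_on UNIV f" and slater: "{y. f y < 0} \<noteq> {}"
    and min: "local_minimizer (P1_objective H c f0) (P1_feasible f) (xs, ys)"
  obtains \<mu> where "\<mu> > 0" "(H + \<mu> *\<^sub>R mat 1) *v xs = - c"
    "grad f0 ys + (\<mu> / 2) *\<^sub>R grad f ys = 0" "xs \<bullet> xs + f ys = 0"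
    "\<And>u w. 2 * (xs \<bullet> u) + grad f ys \<bullet> w = 0 \<Longrightarrow>
      0 \<le> u \<bullet> ((H + \<mu> *\<^sub>R mat 1) *v u) + w \<bullet> ((hess f0 ys + (\<mu> / 2) *\<^sub>R hess f ys) *v w)"
proof -
  interpret constrained_minimizer "P1_objective H c f0" "\<lambda>(x, y). x \<bullet> x + f y"
    "\<lambda>(x, y). (H *v x + c, grad f0 y)" "\<lambda>(x, y). (2 *\<^sub>R x, grad f y)"
    "\<lambda>(u, w). (H *v u, hess f0 ys *v w)" "\<lambda>(u, w). (2 *\<^sub>R u, hess f ys *v w)" "(xs, ys)"
    by (rule P1_constrained_minimizer[OF sym C2 min])
  obtain v where v: "v \<bullet> (H *v v) < 0"
    using npsd sym by (auto simp: psd_def not_le)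
  have active: "xs \<bullet> xs + f ys = 0"
    using inactive[of "(v, 0)"] feasible v by (force simp: inner_commute)
  \<comment> \<open>Otherwise \<open>xs = 0\<close> and activity would give \<open>f ys = 0\<close>,
    while the vanishing gradient would make \<open>ys\<close> a global minimum of \<open>f\<close>,
    against the Slater point.\<close>
  have n: "(2 *\<^sub>R xs, grad f ys) \<noteq> 0"
  proof
    assume "(2 *\<^sub>R xs, grad f ys) = 0"
    then have zero: "xs = 0" "grad f ys = 0"
      by (simp_all add: zero_prod_def)
    obtain y where "f y < 0"
      using slater by auto
    then show False
      using convex_above_tangent[OF conv C2_GDERIV[OF C2(2)], of ys y] active zero by simp
  qed
  obtain m where m: "m \<ge> 0" "(H *v xs + c, grad f0 ys) = - m *\<^sub>R (2 *\<^sub>R xs, grad f ys)"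
    using multiplier n by auto
  have "m \<noteq> 0"
    using second_order_zero_multiplier[of "(v, 0)"] n m v by (auto simp: inner_commute zero_prod_def)
  with m have "m > 0" by simp
  have Hxs: "H *v xs + c = - (2 * m) *\<^sub>R xs" "grad f0 ys = - m *\<^sub>R grad f ys"
    using m(2) by (simp_all add: mult.commute)
  show ?thesis
  \<comment> \<open>The gradient of \<open>x \<bullet> x\<close> is \<open>2 *\<^sub>R x\<close>, so
    the shift of \<open>H\<close> is twice the multiplier.\<close>
  proof (rule that[of "2 * m"])
    show "(H + (2 * m) *\<^sub>R mat 1) *v xs = - c"
      using eq_diff_eq[THEN iffD2, OF Hxs(1)] by (simp add: matrix_shift_mult)
    show "0 \<le> u \<bullet> ((H + (2 * m) *\<^sub>R mat 1) *v u) +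
        w \<bullet> ((hess f0 ys + (2 * m / 2) *\<^sub>R hess f ys) *v w)"
      if "2 * (xs \<bullet> u) + grad f ys \<bullet> w = 0" for u w
      using second_order_lagrangian[of m "(u, w)"] m n that
      by (simp add: matrix_shift_mult inner_add_right matrix_vector_mult_add_rdistrib
          scaleR_matrix_vector_assoc[symmetric] inner_commute algebra_simps)
  qed (use \<open>m > 0\<close> active Hxs(2) in auto)
qed

text \<open>Stationarity trades the linear term for a change of \<open>x \<bullet> x\<close>; for
  moves that preserve \<open>x \<bullet> x\<close>, the change due to \<open>x\<close> is half the
  shifted form.\<close>

lemma P1_objective_shift:
  assumes sym: "transpose H = H" and stat: "(H + \<mu> *\<^sub>R mat 1) *v xs = - c"
  shows "P1_objective H c f0 (xs + d, y) = P1_objective H c f0 (xs, ys) +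
    1/2 * (d \<bullet> ((H + \<mu> *\<^sub>R mat 1) *v d)) - \<mu>/2 * ((xs + d) \<bullet> (xs + d) - xs \<bullet> xs) + f0 y - f0 ys"
proof -
  have "H *v xs = - c - \<mu> *\<^sub>R xs"
    using stat unfolding matrix_shift_mult by (simp add: algebra_simps)
  then have "d \<bullet> (H *v xs) = - (c \<bullet> d) - \<mu> * (xs \<bullet> d)"
    by (simp add: inner_diff_right inner_commute)
  then show ?thesis
    using symmetric_quadratic_expand[OF sym, of xs 1 d]
    by (simp add: P1_objective_def matrix_shift_mult inner_add_left inner_add_right
        inner_commute algebra_simps add_divide_distrib diff_divide_distrib)
qed

text \<open>At a better feasible point \<open>(x, y)\<close>, the tangent inequalities of
  \<open>f0\<close> and \<open>f\<close>, weighted by 1 and \<open>\<mu> / 2\<close>, have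
  cancelling gradient terms; what remains forces the shifted form to be negative at
  \<open>x - xs\<close>.\<close>

lemma P1_nonglobal_shift_not_psd:
  assumes sym: "transpose H = H" and C2: "C2 f0" "C2 f"
    and conv: "convex_on UNIV f0" "convex_on UNIV f"
    and \<mu>: "\<mu> > 0" "(H + \<mu> *\<^sub>R mat 1) *v xs = - c"
    and grad: "grad f0 ys + (\<mu> / 2) *\<^sub>R grad f ys = 0" and active: "xs \<bullet> xs + f ys = 0"
    and nonglobal: "\<not> global_minimizer (P1_objective H c f0) (P1_feasible f) (xs, ys)"
  obtains v where "v \<bullet> ((H + \<mu> *\<^sub>R mat 1) *v v) < 0"
proof -
  have "(xs, ys) \<in> P1_feasible f"
    using active by (simp add: P1_feasible_def)
  then obtain x y where xy: "x \<bullet> x + f y \<le> 0"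
    "P1_objective H c f0 (x, y) < P1_objective H c f0 (xs, ys)"
    using nonglobal by (force simp: global_minimizer_def P1_feasible_def)
  have "f0 ys + grad f0 ys \<bullet> (y - ys) \<le> f0 y"
    by (rule convex_above_tangent[OF conv(1) C2_GDERIV[OF C2(1)]])
  moreover have "\<mu> / 2 * (f ys + grad f ys \<bullet> (y - ys)) \<le> \<mu> / 2 * f y"
    using convex_above_tangent[OF conv(2) C2_GDERIV[OF C2(2)]] \<mu>(1) by (intro mult_left_mono) auto
  moreover have "grad f0 ys \<bullet> (y - ys) + \<mu> / 2 * (grad f ys \<bullet> (y - ys)) = 0"
    using arg_cong[OF grad, of "\<lambda>g. g \<bullet> (y - ys)"] by (simp add: inner_add_left)
  moreover have "\<mu> / 2 * (x \<bullet> x + f y) \<le> 0"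
    using xy(1) \<mu>(1) by (intro mult_nonneg_nonpos) auto
  moreover have "\<mu> / 2 * (xs \<bullet> xs) = \<mu> / 2 * (- f ys)"
    using active by (intro arg_cong2[where f = "(*)"]) auto
  ultimately have "(x - xs) \<bullet> ((H + \<mu> *\<^sub>R mat 1) *v (x - xs)) < 0"
    using xy(2) P1_objective_shift[OF sym \<mu>(2), of f0 "x - xs" y ys]
    by (simp add: algebra_simps)
  then show ?thesis by (rule that)
qed

text \<open>In the plane spanned by the eigenvectors of \<open>\<lambda>\<^sub>1\<close> and \<open>\<lambda>\<^sub>2\<close>, the second-order condition only
  yields \<open>\<mu> \<ge> - \<lambda>\<^sub>2\<close> with \<open>xs\<close> orthogonal to \<open>v\<^sub>2\<close> in the case of equality. That case is excluded by
  moving along the circle on which the constraint stays active.\<close>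

lemma P1_multiplier_gt_second:
  assumes sym: "transpose H = H"
    and min: "local_minimizer (P1_objective H c f0) (P1_feasible f) (xs, ys)"
    and stat: "(H + \<mu> *\<^sub>R mat 1) *v xs = - c"
    and sonc: "\<And>u. xs \<bullet> u = 0 \<Longrightarrow> 0 \<le> u \<bullet> ((H + \<mu> *\<^sub>R mat 1) *v u)"
    and v: "norm v1 = 1" "norm v2 = 1" "v1 \<bullet> v2 = 0"
    and eig: "H *v v1 = l1 *\<^sub>R v1" "H *v v2 = l2 *\<^sub>R v2" and l1: "\<mu> < - l1"
  shows "- l2 < \<mu>"
proof (rule ccontr)
  assume l2: "\<not> - l2 < \<mu>"
  define p q where "p = xs \<bullet> v1" and "q = xs \<bullet> v2"
  have vv: "v1 \<bullet> v1 = 1" "v2 \<bullet> v2 = 1" "v2 \<bullet> v1 = 0"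
    using v by (simp_all add: dot_square_norm inner_commute)
  have quad: "(a *\<^sub>R v1 + b *\<^sub>R v2) \<bullet> ((H + \<mu> *\<^sub>R mat 1) *v (a *\<^sub>R v1 + b *\<^sub>R v2)) =
      a\<^sup>2 * (l1 + \<mu>) + b\<^sup>2 * (l2 + \<mu>)" for a b
    by (simp add: matrix_shift_mult matrix_vector_right_distrib matrix_vector_mult_scaleR eig
        inner_add_left inner_add_right vv v power2_eq_square algebra_simps)
  \<comment> \<open>The vector \<open>q *\<^sub>R v1 - p *\<^sub>R v2\<close> is orthogonal to
    \<open>xs\<close>, so the second-order condition applies to it.\<close>
  have "0 \<le> q\<^sup>2 * (l1 + \<mu>) + p\<^sup>2 * (l2 + \<mu>)"
    using sonc[of "q *\<^sub>R v1 + (- p) *\<^sub>R v2"] quad[of q "- p"]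
    by (simp add: inner_diff_right p_def q_def)
  moreover have "p\<^sup>2 * (l2 + \<mu>) \<le> 0"
    using l2 by (intro mult_nonneg_nonpos) auto
  ultimately have "0 \<le> q\<^sup>2 * (l1 + \<mu>)" by simp
  then have q: "q = 0"
    using l1 by (auto simp: zero_le_mult_iff)
  \<comment> \<open>If \<open>p\<close> were 0, \<open>v1\<close> would itself be orthogonal to
    \<open>xs\<close>, with negative form.\<close>
  have p: "p \<noteq> 0"
    using sonc[of v1] quad[of 1 0] l1 by (auto simp: p_def)
  obtain e where e: "e > 0"
    "\<And>w. w \<in> P1_feasible f \<Longrightarrow> dist w (xs, ys) < e \<Longrightarrow>
      P1_objective H c f0 (xs, ys) \<le> P1_objective H c f0 w"
    using min by (auto simp: local_minimizer_def)
  \<comment> \<open>The first bound keeps the radicand in \<open>b\<close> nonnegative; the second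
    gives \<open>d \<bullet> d \<le> e\<^sup>2 / 2\<close>.\<close>
  define s where "s = min \<bar>p\<bar> (e\<^sup>2 / (4 * \<bar>p\<bar>))"
  have s: "0 < s" "s \<le> \<bar>p\<bar>" "s \<le> e\<^sup>2 / (4 * \<bar>p\<bar>)"
    using p e by (simp_all add: s_def)
  \<comment> \<open>These solve \<open>2 * a * p + a\<^sup>2 + b\<^sup>2 = 0\<close>, which keeps
    \<open>xs + d\<close> on the sphere through \<open>xs\<close>.\<close>
  define a b where "a = - sgn p * s" and "b = sqrt (2 * s * \<bar>p\<bar> - s\<^sup>2)"
  define d where "d = a *\<^sub>R v1 + b *\<^sub>R v2"
  have "s * s \<le> s * (2 * \<bar>p\<bar>)"
    using s by (intro mult_left_mono) auto
  then have b: "b\<^sup>2 = 2 * s * \<bar>p\<bar> - s\<^sup>2"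
    by (simp add: b_def power2_eq_square algebra_simps)
  have a: "a\<^sup>2 = s\<^sup>2" "a * p = - s * \<bar>p\<bar>"
    using p by (auto simp: a_def power_mult_distrib sgn_if)
  have dd: "d \<bullet> d = 2 * s * \<bar>p\<bar>"
    using a b by (simp add: d_def inner_add_left inner_add_right vv v power2_eq_square)
  have "xs \<bullet> d = a * p"
    using q by (simp add: d_def inner_add_right p_def q_def)
  then have sphere: "(xs + d) \<bullet> (xs + d) = xs \<bullet> xs"
    using dd a by (simp add: inner_add_left inner_add_right inner_commute)
  have "(xs, ys) \<in> P1_feasible f"
    using min by (simp add: local_minimizer_def)
  then have "(xs + d, ys) \<in> P1_feasible f"
    by (simp add: P1_feasible_def sphere)
  moreover have "dist (xs + d, ys) (xs, ys) < e"
  proof -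
    have "(norm d)\<^sup>2 \<le> e\<^sup>2 / 2"
      using s p dd by (simp add: dot_square_norm field_simps)
    also have "\<dots> < e\<^sup>2" using e by simp
    finally have "norm d < e"
      using e by (meson less_imp_le power_less_imp_less_base)
    then show ?thesis by (simp add: dist_prod_def dist_norm)
  qed
  ultimately have "P1_objective H c f0 (xs, ys) \<le> P1_objective H c f0 (xs + d, ys)"
    by (rule e(2))
  then have "0 \<le> a\<^sup>2 * (l1 + \<mu>) + b\<^sup>2 * (l2 + \<mu>)"
    using P1_objective_shift[OF sym stat, of f0 d ys ys] sphere quad[of a b] by (simp add: d_def)
  moreover have "a\<^sup>2 * (l1 + \<mu>) < 0"
    using a s l1 by (simp add: mult_pos_neg)
  moreover have "b\<^sup>2 * (l2 + \<mu>) \<le> 0"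
    using l2 by (intro mult_nonneg_nonpos) auto
  ultimately show False by simp
qed

section \<open>Derivative of \<open>phi\<close> and the bound through inverse matrices\<close>

lemma matrix_inv_mult_vector:
  fixes A :: "real^'n^'n"
  assumes "invertible A"
  shows "A *v (matrix_inv A *v v) = v" "matrix_inv A *v (A *v v) = v"
  using someI_ex[OF assms[unfolded invertible_def], folded matrix_inv_def]
  by (simp_all add: matrix_vector_mul_assoc)

text \<open>The resolvent identity expresses \<open>N \<nu> - N \<mu>\<close> as
  \<open>- (\<nu> - \<mu>)\<close> times the product of \<open>N \<nu>\<close> and
  \<open>N \<mu>\<close>. With a uniform bound on \<open>N \<nu>\<close> it gives continuity of
  \<open>N\<close> at \<open>\<mu>\<close>, and then the limit of the difference quotient.\<close>

lemma phi_has_derivative: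
  fixes H :: "real^'n^'n" and c :: "real^'n"
  defines "N \<equiv> \<lambda>\<nu>. matrix_inv (H + \<nu> *\<^sub>R mat 1)"
  assumes inv: "invertible (H + \<mu> *\<^sub>R mat 1)"
  shows "(phi H c has_real_derivative - 2 * ((N \<mu> *v c) \<bullet> (N \<mu> *v (N \<mu> *v c)))) (at \<mu>)"
proof -
  obtain K where K: "K > 0" "\<And>v. norm (N \<mu> *v v) \<le> norm v * K"
    using bounded_linear.pos_bounded[OF matrix_vector_mul_bounded_linear[of "N \<mu>"]] by blast
  \<comment> \<open>For \<open>\<nu>\<close> this close to \<open>\<mu>\<close>, the perturbation
    absorbs at most half of \<open>norm z\<close>; hence invertibility and the bound
    \<open>2 * K\<close> on the inverse.\<close>
  have lower: "norm z \<le> 2 * K * norm ((H + \<nu> *\<^sub>R mat 1) *v z)" if \<nu>: "\<bar>\<nu> - \<mu>\<bar> \<le> 1 / (2 * K)" for \<nu> z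
  proof -
    let ?w = "(H + \<nu> *\<^sub>R mat 1) *v z"
    have "z = N \<mu> *v ((H + \<mu> *\<^sub>R mat 1) *v z)"
      using inv by (simp add: N_def matrix_inv_mult_vector)
    also have "(H + \<mu> *\<^sub>R mat 1) *v z = ?w - (\<nu> - \<mu>) *\<^sub>R z"
      by (simp add: matrix_shift_mult algebra_simps)
    finally have "norm z \<le> norm (?w - (\<nu> - \<mu>) *\<^sub>R z) * K"
      using K(2) by metis
    also have "\<dots> \<le> (norm ?w + \<bar>\<nu> - \<mu>\<bar> * norm z) * K"
      using K(1) norm_triangle_ineq4[of ?w "(\<nu> - \<mu>) *\<^sub>R z"] by (intro mult_right_mono) auto
    also have "\<dots> \<le> (norm ?w + 1 / (2 * K) * norm z) * K"
      using K(1) \<nu> by (intro mult_right_mono add_left_mono) auto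
    also have "\<dots> = norm ?w * K + norm z / 2"
      using K(1) by (simp add: field_simps)
    finally have "norm z \<le> 2 * (norm ?w * K)" by linarith
    then show ?thesis by (simp only: mult_ac)
  qed
  have inv': "invertible (H + \<nu> *\<^sub>R mat 1)" if "\<bar>\<nu> - \<mu>\<bar> \<le> 1 / (2 * K)" for \<nu>
    unfolding invertible_left_inverse matrix_left_invertible_ker
    using lower[OF that] by (metis mult_zero_right norm_le_zero_iff norm_zero)
  have near: "\<forall>\<^sub>F \<nu> in at \<mu>. \<bar>\<nu> - \<mu>\<bar> \<le> 1 / (2 * K)"
    unfolding eventually_at using K(1)
    by (intro exI[of _ "1 / (2 * K)"]) (auto simp: dist_real_def)
  have resolvent: "N \<nu> *v v = N \<mu> *v v - (\<nu> - \<mu>) *\<^sub>R (N \<nu> *v (N \<mu> *v v))"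
    if "\<bar>\<nu> - \<mu>\<bar> \<le> 1 / (2 * K)" for \<nu> v
  proof -
    have "(H + \<nu> *\<^sub>R mat 1) *v (N \<mu> *v v) = v + (\<nu> - \<mu>) *\<^sub>R (N \<mu> *v v)"
      using matrix_inv_mult_vector(1)[OF inv, of v]
      by (simp add: N_def matrix_shift_mult algebra_simps)
    then have "N \<mu> *v v = N \<nu> *v (v + (\<nu> - \<mu>) *\<^sub>R (N \<mu> *v v))"
      using matrix_inv_mult_vector(2)[OF inv'[OF that]] by (metis N_def)
    then show ?thesis
      by (simp add: matrix_vector_right_distrib matrix_vector_mult_scaleR eq_diff_eq)
  qed
  have lim: "((\<lambda>\<nu>. N \<nu> *v v) \<longlongrightarrow> N \<mu> *v v) (at \<mu>)" for v
  proof (rule Lim_transform2[where f = "\<lambda>_. N \<mu> *v v"])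
    show "((\<lambda>\<nu>. N \<mu> *v v) \<longlongrightarrow> N \<mu> *v v) (at \<mu>)" by simp
    have bnd: "norm (N \<mu> *v v - N \<nu> *v v) \<le> \<bar>\<nu> - \<mu>\<bar> * (2 * K * norm (N \<mu> *v v))"
      if \<nu>: "\<bar>\<nu> - \<mu>\<bar> \<le> 1 / (2 * K)" for \<nu>
    proof -
      have "norm (N \<mu> *v v - N \<nu> *v v) = \<bar>\<nu> - \<mu>\<bar> * norm (N \<nu> *v (N \<mu> *v v))"
        by (subst resolvent[OF \<nu>]) simp
      also have "norm (N \<nu> *v (N \<mu> *v v)) \<le> 2 * K * norm (N \<mu> *v v)"
        using lower[OF \<nu>, of "N \<nu> *v (N \<mu> *v v)"] matrix_inv_mult_vector(1)[OF inv'[OF \<nu>]]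
        by (simp add: N_def)
      finally show ?thesis by (simp add: mult_left_mono)
    qed
    have "((\<lambda>\<nu>. \<bar>\<nu> - \<mu>\<bar> * (2 * K * norm (N \<mu> *v v))) \<longlongrightarrow> \<bar>\<mu> - \<mu>\<bar> * (2 * K * norm (N \<mu> *v v))) (at \<mu>)"
      by (intro tendsto_intros)
    then show "((\<lambda>\<nu>. N \<mu> *v v - N \<nu> *v v) \<longlongrightarrow> 0) (at \<mu>)"
      by (intro Lim_null_comparison[OF eventually_mono[OF near bnd]]) simp_all
  qed
  have phi: "phi H c \<nu> = (N \<nu> *v c) \<bullet> (N \<nu> *v c)" for \<nu>
    by (simp add: phi_def N_def dot_square_norm)
  \<comment> \<open>The difference of squared norms factors into difference and sum, and the
    resolvent identity extracts \<open>\<nu> - \<mu>\<close> from the difference.\<close>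
  have quot: "- ((N \<nu> *v (N \<mu> *v c)) \<bullet> (N \<nu> *v c + N \<mu> *v c)) = (phi H c \<nu> - phi H c \<mu>) / (\<nu> - \<mu>)"
    if "\<bar>\<nu> - \<mu>\<bar> \<le> 1 / (2 * K)" "\<nu> \<noteq> \<mu>" for \<nu>
  proof -
    have "phi H c \<nu> - phi H c \<mu> = (N \<nu> *v c - N \<mu> *v c) \<bullet> (N \<nu> *v c + N \<mu> *v c)"
      by (simp add: phi inner_diff_left inner_add_right inner_commute[of "N \<mu> *v c" "N \<nu> *v c"])
    also have "N \<nu> *v c - N \<mu> *v c = - (\<nu> - \<mu>) *\<^sub>R (N \<nu> *v (N \<mu> *v c))"
      by (subst resolvent[OF that(1)]) (simp add: algebra_simps)
    finally show ?thesis
      using that(2) by (simp add: eq_divide_eq algebra_simps)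
  qed
  have "((\<lambda>\<nu>. - ((N \<nu> *v (N \<mu> *v c)) \<bullet> (N \<nu> *v c + N \<mu> *v c))) \<longlongrightarrow>
      - ((N \<mu> *v (N \<mu> *v c)) \<bullet> (N \<mu> *v c + N \<mu> *v c))) (at \<mu>)"
    by (intro tendsto_intros lim)
  moreover have "\<forall>\<^sub>F \<nu> in at \<mu>. - ((N \<nu> *v (N \<mu> *v c)) \<bullet> (N \<nu> *v c + N \<mu> *v c)) =
      (phi H c \<nu> - phi H c \<mu>) / (\<nu> - \<mu>)"
    using near eventually_neq_at_within[of \<mu> \<mu> UNIV] by eventually_elim (rule quot)
  ultimately have "((\<lambda>\<nu>. (phi H c \<nu> - phi H c \<mu>) / (\<nu> - \<mu>)) \<longlongrightarrow>
      - ((N \<mu> *v (N \<mu> *v c)) \<bullet> (N \<mu> *v c + N \<mu> *v c))) (at \<mu>)"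
    by (rule Lim_transform_eventually)
  also have "- ((N \<mu> *v (N \<mu> *v c)) \<bullet> (N \<mu> *v c + N \<mu> *v c)) =
      - 2 * ((N \<mu> *v c) \<bullet> (N \<mu> *v (N \<mu> *v c)))"
    by (subst inner_add_right) (simp add: inner_commute)
  finally show ?thesis
    by (simp only: has_field_derivative_iff)
qed

text \<open>The direction \<open>q = matrix_inv M *v x\<close>, completed to a tangent pair by a
  multiple of \<open>r = matrix_inv B *v g\<close>, gives
  \<open>0 \<le> X + 4 * X\<^sup>2 / Y\<close>. The bound follows once \<open>X < 0\<close> is
  known.\<close>

lemma sonc_inverse_bound:
  fixes M :: "real^'n^'n" and B :: "real^'m^'m"
  assumes sym: "transpose M = M" and M: "invertible M" and B: "invertible B"
    and x: "x \<noteq> 0" and u: "u \<bullet> (M *v u) < 0" and pos: "\<And>w. 0 \<le> w \<bullet> (B *v w)"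
    and sonc: "\<And>u w. 2 * (x \<bullet> u) + g \<bullet> w = 0 \<Longrightarrow> 0 \<le> u \<bullet> (M *v u) + w \<bullet> (B *v w)"
  shows "g \<bullet> (matrix_inv B *v g) \<le> - 4 * (x \<bullet> (matrix_inv M *v x))"
proof -
  define q r where "q = matrix_inv M *v x" and "r = matrix_inv B *v g"
  define X Y where "X = x \<bullet> q" and "Y = g \<bullet> r"
  have Mq: "M *v q = x" and Br: "B *v r = g"
    using M B by (simp_all add: q_def r_def matrix_inv_mult_vector)
  have qx: "q \<bullet> x = X" "r \<bullet> g = Y"
    by (simp_all add: X_def Y_def inner_commute)
  have Y: "Y \<ge> 0"
    using pos[of r] by (simp add: Br qx)
  have X: "X \<le> 0"
  proof (rule ccontr)
    assume "\<not> X \<le> 0"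
    \<comment> \<open>This \<open>t\<close> makes \<open>u + t *\<^sub>R q\<close> orthogonal to
      \<open>x\<close>; since \<open>M *v q = x\<close>, its form is
      \<open>u \<bullet> (M *v u) - t\<^sup>2 * X\<close>, negative if \<open>X > 0\<close>.\<close>
    define t where "t = - (x \<bullet> u) / X"
    have t: "x \<bullet> u = - t * X"
      using \<open>\<not> X \<le> 0\<close> by (simp add: t_def)
    have "x \<bullet> (u + t *\<^sub>R q) = 0"
      by (simp add: inner_add_right t flip: X_def)
    then have "0 \<le> (u + t *\<^sub>R q) \<bullet> (M *v (u + t *\<^sub>R q))"
      using sonc[of "u + t *\<^sub>R q" 0] by simp
    also have "\<dots> = u \<bullet> (M *v u) - t\<^sup>2 * X"
      using symmetric_inner_commute[OF sym, of q u]
      by (simp add: symmetric_quadratic_expand[OF sym] Mq qx t inner_commute[of u x] power2_eq_square)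
    finally have "0 \<le> u \<bullet> (M *v u) - t\<^sup>2 * X" .
    moreover have "0 \<le> t\<^sup>2 * X"
      using \<open>\<not> X \<le> 0\<close> by simp
    ultimately show False using u by simp
  qed
  have "Y \<le> - 4 * X"
  proof (cases "Y = 0")
    case True
    then show ?thesis using X by simp
  next
    case False
    with Y have Y: "Y > 0" by simp
    define S where "S = x \<bullet> x"
    have "S > 0" using x by (simp add: S_def)
    \<comment> \<open>The case \<open>t = 0\<close> is void when \<open>X = 0\<close>; small \<open>t\<close> exclude that degenerate case.\<close>
    have ineq: "0 \<le> X + 2 * t * S + t\<^sup>2 * (x \<bullet> (M *v x)) + (2 * X + 2 * t * S)\<^sup>2 / Y" for t
    proof -
      \<comment> \<open>\<open>\<beta>\<close> solves the tangency equation
        \<open>2 * X + 2 * t * S + \<beta> * Y = 0\<close>.\<close>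
      define \<beta> where "\<beta> = - ((2 * X + 2 * t * S) / Y)"
      have "0 \<le> (q + t *\<^sub>R x) \<bullet> (M *v (q + t *\<^sub>R x)) + (\<beta> *\<^sub>R r) \<bullet> (B *v (\<beta> *\<^sub>R r))"
        using Y by (intro sonc) (simp add: inner_add_right \<beta>_def flip: X_def Y_def S_def)
      also have "\<beta> *\<^sub>R r \<bullet> (B *v (\<beta> *\<^sub>R r)) = \<beta>\<^sup>2 * Y"
        by (simp add: matrix_vector_mult_scaleR Br qx power2_eq_square)
      also have "\<dots> = (2 * X + 2 * t * S)\<^sup>2 / Y"
        using Y by (simp only: \<beta>_def power2_minus power_divide) (simp add: power2_eq_square[of Y])
      finally show ?thesis
        by (simp add: symmetric_quadratic_expand[OF sym] Mq qx flip: S_def)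
    qed
    have "X \<noteq> 0"
    proof
      assume "X = 0"
      then have "0 \<le> 2 * t * S + t\<^sup>2 * (x \<bullet> (M *v x) + 4 * S\<^sup>2 / Y)" for t
        using ineq[of t] by (simp add: power_mult_distrib algebra_simps)
      then have "S = 0" by (rule linear_nonneg_quadratic_zero)
      with \<open>S > 0\<close> show False by simp
    qed
    with X have "X < 0" by simp
    moreover have "0 \<le> X * (Y + 4 * X)"
      using ineq[of 0] Y by (simp add: field_simps power2_eq_square)
    ultimately show ?thesis
      by (simp add: zero_le_mult_iff)
  qed
  then show ?thesis by (simp add: X_def Y_def q_def r_def)
qed

theorem theorem5:
  fixes H :: "real^'n^'n" and c xs :: "real^'n"
    and f0 f :: "real^'m \<Rightarrow> real" and ys :: "real^'m"
  assumes "CARD('n) \<ge> 2"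
    and "transpose H = H"
    and "\<not> psd H"
    and "convex_on UNIV f0" and "C2 f0"
    and "convex_on UNIV f" and "C2 f"
    and "{y. f y < 0} \<noteq> {}"
    and "local_nonglobal_minimizer (P1_objective H c f0) (P1_feasible f) (xs, ys)"
  shows "\<exists>\<mu>\<in>{max 0 (- eigval H 2)<..<- eigval H 1}.
      (H + \<mu> *\<^sub>R mat 1) *v xs = - c \<and>
      grad f0 ys + (\<mu> / 2) *\<^sub>R grad f ys = 0 \<and>
      xs \<bullet> xs + f ys = 0 \<and>
      ((\<forall>y. f y < 0 \<longrightarrow> (\<exists>\<mu>\<^sub>y>0. posdef (hess f0 y + (\<mu>\<^sub>y / 2) *\<^sub>R hess f y))) \<longrightarrow>
        deriv (phi H c) \<mu> \<ge>
          1/2 * (grad f ys \<bullet> (matrix_inv (hess f0 ys + (\<mu> / 2) *\<^sub>R hess f ys) *v grad f ys)))"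
proof -
  note sym = assms(2) and min = assms(9)[unfolded local_nonglobal_minimizer_def]
  obtain \<mu> where \<mu>: "\<mu> > 0" "(H + \<mu> *\<^sub>R mat 1) *v xs = - c"
    "grad f0 ys + (\<mu> / 2) *\<^sub>R grad f ys = 0" "xs \<bullet> xs + f ys = 0"
    and sonc: "\<And>u w. 2 * (xs \<bullet> u) + grad f ys \<bullet> w = 0 \<Longrightarrow>
      0 \<le> u \<bullet> ((H + \<mu> *\<^sub>R mat 1) *v u) + w \<bullet> ((hess f0 ys + (\<mu> / 2) *\<^sub>R hess f ys) *v w)"
    using P1_necessary_conditions[OF sym assms(3,5,7,6,8)] min by blast
  obtain v1 v2 where v: "norm v1 = 1" "norm v2 = 1" "v1 \<bullet> v2 = 0"
    and eig: "H *v v1 = eigval H 1 *\<^sub>R v1" "H *v v2 = eigval H 2 *\<^sub>R v2"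
    and lower: "\<And>v. eigval H 1 * (v \<bullet> v) \<le> v \<bullet> (H *v v)"
    and nonroot: "\<And>t. eigval H 1 < t \<Longrightarrow> t < eigval H 2 \<Longrightarrow> det (mat t - H) \<noteq> 0"
    using eigval_structure[OF sym assms(1)] by blast
  obtain u where u: "u \<bullet> ((H + \<mu> *\<^sub>R mat 1) *v u) < 0"
    using P1_nonglobal_shift_not_psd[OF sym assms(5,7,4,6) \<mu>] min by blast
  have sonc0: "0 \<le> u \<bullet> ((H + \<mu> *\<^sub>R mat 1) *v u)" if "xs \<bullet> u = 0" for u
    using sonc[of u 0] that by simp
  have "\<mu> < - eigval H 1"
  proof -
    have "(eigval H 1 + \<mu>) * (u \<bullet> u) \<le> u \<bullet> ((H + \<mu> *\<^sub>R mat 1) *v u)"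
      using lower[of u] by (simp add: matrix_shift_mult inner_add_right distrib_right)
    with u have "(eigval H 1 + \<mu>) * (u \<bullet> u) < 0" by simp
    then show ?thesis
      using inner_ge_zero[of u] by (auto simp: mult_less_0_iff)
  qed
  moreover have "- eigval H 2 < \<mu>"
    using P1_multiplier_gt_second[OF sym _ \<mu>(2) sonc0 v eig calculation] min by blast
  moreover have "1/2 * (grad f ys \<bullet> (matrix_inv (hess f0 ys + (\<mu> / 2) *\<^sub>R hess f ys) *v grad f ys))
      \<le> deriv (phi H c) \<mu>"
    if reg: "\<forall>y. f y < 0 \<longrightarrow> (\<exists>\<mu>\<^sub>y>0. posdef (hess f0 y + (\<mu>\<^sub>y / 2) *\<^sub>R hess f y))"
  proof -
    define M where "M = H + \<mu> *\<^sub>R mat 1"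
    define B where "B = hess f0 ys + (\<mu> / 2) *\<^sub>R hess f ys"
    \<comment> \<open>Were \<open>xs\<close> zero, the second-order condition would cover
      \<open>u\<close>, whose form is negative. Activity then yields \<open>f ys < 0\<close>, so the
      regularity hypothesis applies at \<open>ys\<close>.\<close>
    have "xs \<noteq> 0"
      using sonc0[of u] u by auto
    then have "f ys < 0"
      using \<mu>(4) by (simp add: add_eq_0_iff flip: inner_gt_zero_iff)
    then obtain \<nu> where \<nu>: "\<nu> > 0" "posdef (hess f0 ys + (\<nu> / 2) *\<^sub>R hess f ys)"
      using reg by blast
    have B_mult: "w \<bullet> (B *v w) = w \<bullet> (hess f0 ys *v w) + \<mu> / 2 * (w \<bullet> (hess f ys *v w))" for w
      by (simp add: B_def matrix_vector_mult_add_rdistrib scaleR_matrix_vector_assoc[symmetric]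
          inner_add_right)
    \<comment> \<open>Regularity speaks of some \<open>\<nu>\<close>, not of \<open>\<mu>\<close>.
      Both Hessian forms are nonnegative, so positivity for one positive weight means that one of
      them is positive, which suffices for every positive weight.\<close>
    have B_pos: "0 < w \<bullet> (B *v w)" if "w \<noteq> 0" for w
    proof -
      have "0 < w \<bullet> (hess f0 ys *v w) + \<nu> / 2 * (w \<bullet> (hess f ys *v w))"
        using \<nu>(2) that
        by (simp add: posdef_def matrix_vector_mult_add_rdistrib scaleR_matrix_vector_assoc[symmetric]
            inner_add_right)
      moreover have "0 \<le> w \<bullet> (hess f0 ys *v w)" "0 \<le> w \<bullet> (hess f ys *v w)"
        using assms(4-7) by (simp_all add: convex_hess_nonneg)
      ultimately have "0 < w \<bullet> (hess f0 ys *v w) \<or> 0 < w \<bullet> (hess f ys *v w)"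
        by fastforce
      then show ?thesis
        using \<open>0 \<le> w \<bullet> (hess f0 ys *v w)\<close> \<open>0 \<le> w \<bullet> (hess f ys *v w)\<close> \<mu>(1)
        by (auto simp: B_mult intro: add_pos_nonneg add_nonneg_pos)
    qed
    then have B_nonneg: "0 \<le> w \<bullet> (B *v w)" for w
      by (cases "w = 0") (auto simp: less_imp_le)
    have "invertible B"
      unfolding invertible_left_inverse matrix_left_invertible_ker
      using B_pos by (metis inner_zero_right less_irrefl)
    moreover have "invertible M"
    proof -
      \<comment> \<open>\<open>- \<mu>\<close> lies strictly between the first two eigenvalues,
        hence is not a root of the characteristic polynomial.\<close>
      have "(mat (- \<mu>) - H) *v v = - (M *v v)" for v
        by (simp add: M_def matrix_shift_mult matrix_vector_mult_diff_rdistrib mat_mult_vector)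
      moreover have "invertible (mat (- \<mu>) - H)"
        using nonroot[of "- \<mu>"] \<open>\<mu> < - eigval H 1\<close> \<open>- eigval H 2 < \<mu>\<close>
        by (simp add: invertible_det_nz)
      ultimately show ?thesis
        unfolding invertible_left_inverse matrix_left_invertible_ker by simp
    qed
    moreover have "transpose M = M"
      unfolding M_def by (rule transpose_shift[OF sym])
    ultimately have bound: "grad f ys \<bullet> (matrix_inv B *v grad f ys) \<le> - 4 * (xs \<bullet> (matrix_inv M *v xs))"
      using \<open>xs \<noteq> 0\<close> u sonc B_nonneg
      by (intro sonc_inverse_bound) (auto simp: M_def B_def)
    \<comment> \<open>Both factors of the derivative formula change sign under
      \<open>c = - M *v xs\<close>, leaving
      \<open>- 2 * (xs \<bullet> (matrix_inv M *v xs))\<close>, half the right-hand side of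
      \<open>bound\<close>.\<close>
    have "matrix_inv M *v c = (- 1) *\<^sub>R (matrix_inv M *v (- c))"
      by (simp only: matrix_vector_mult_scaleR[symmetric]) simp
    also have "matrix_inv M *v (- c) = xs"
      using matrix_inv_mult_vector(2)[OF \<open>invertible M\<close>, of xs] \<mu>(2) by (simp add: M_def)
    finally have inv_c: "matrix_inv M *v c = (- 1) *\<^sub>R xs" .
    have "deriv (phi H c) \<mu> = - 2 * (xs \<bullet> (matrix_inv M *v xs))"
      using DERIV_imp_deriv[OF phi_has_derivative[OF \<open>invertible M\<close>[unfolded M_def], of c]]
      by (simp only: inv_c matrix_vector_mult_scaleR flip: M_def) simp
    with bound show ?thesis by (simp add: B_def)
  qed
  ultimately show ?thesis
    using \<mu> by (intro bexI[of _ \<mu>]) auto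
qed

end
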